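(* Let $L_1=(L_1,\bullet_1)$ and $L_2=(L_2,\bullet_2)$ be left quasigroups, let $M=(M,\mu)$ be a ternary system satisfying, for all $a,b,c,d\in M$, $$\mu(a,\mu(a,b,c),\mu(\mu(a,b,c),c,d))=\mu(a,b,\mu(b,c,d)),$$ $$\mu(\mu(a,b,c),c,d)=\mu(\mu(a,b,\mu(b,c,d)),\mu(b,c,d),d),$$ and let $\pi_i:L_i\to M$ $(i=1,2)$ be bijections. Then for every $\lambda_1\in L_1$, $$R^{(L_1,M,\pi_1)}(\lambda_1)=J(\lambda_1)^{-1}\,R^{(L_2,M,\pi_2)\,21}(\pi_2^{-1}\pi_1(\lambda_1))\,J^{21}(\lambda_1),$$ where $J(\lambda_1)$, $J^{21}(\lambda_1)$ and $R^{(L_2,M,\pi_2)\,21}$ are defined in the context.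
   Context: A left quasigroup $(L,\cdot)$ is a nonempty set $L$ with a binary operation such that for all $u,w\in L$ there is a unique $v\in L$ with $u\cdot v=w$; this $v$ is denoted $u\backslash_L w$, and $uv$ means $u\cdot v$. A ternary system $(M,\mu)$ is a nonempty set $M$ with a map $\mu:M^3\to M$. Given a left quasigroup $L$, a ternary system $M=(M,\mu)$ and a bijection $\pi:L\to M$, for $\lambda,u,v\in L$: $$\xi^{(L,M,\pi)}_\lambda(u)(v)=\lambda\backslash_L\pi^{-1}\bigl(\mu(\pi(\lambda),\pi(\lambda u),\pi((\lambda u)v))\bigr),$$ $$\eta^{(L,M,\pi)}_\lambda(u)(v)=\bigl(\lambda\,\xi^{(L,M,\pi)}_\lambda(v)(u)\bigr)\backslash_L\bigl((\lambda v)u\bigr),$$ $$R^{(L,M,\pi)}(\lambda)(u,v)=\bigl(\eta^{(L,M,\pi)}_\lambda(v)(u),\xi^{(L,M,\pi)}_\lambda(u)(v)\bigr).$$ For a set $X$, $P_X(u,v)=(v,u)$ on $X\times X$. For $i=1,2$ and $\lambda_i\in L_i$, $\tilde f^{(i)}_{\lambda_i}:L_i\times L_i\to L_i\times L_i$ is the bijection $\tilde f^{(i)}_{\lambda_i}(u,v)=(\lambda_i\bullet_i u,\ (\lambda_i\bullet_i u)\bullet_i v)$. Define the (bijective) map $J(\lambda_1):L_1\times L_1\to L_2\times L_2$ by $$J(\lambda_1)=\bigl(\tilde f^{(2)}_{\pi_2^{-1}\pi_1(\lambda_1)}\bigr)^{-1}\,(\pi_2^{-1}\pi_1\times\pi_2^{-1}\pi_1)\,\tilde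 f^{(1)}_{\lambda_1}\,P_{L_1},$$ and set $J^{21}(\lambda_1)=P_{L_2}J(\lambda_1)P_{L_1}$ and $R^{(L_2,M,\pi_2)\,21}(\lambda_2)=P_{L_2}R^{(L_2,M,\pi_2)}(\lambda_2)P_{L_2}$ for $\lambda_2\in L_2$. *)

theory Defs
  imports Main
begin

locale left_quasigroup =
  fixes L :: "'a set" and op :: "'a \<Rightarrow> 'a \<Rightarrow> 'a"
  assumes nonempty: "L \<noteq> {}"
    and closed: "u \<in> L \<Longrightarrow> v \<in> L \<Longrightarrow> op u v \<in> L"
    and unique_solution: "u \<in> L \<Longrightarrow> w \<in> L \<Longrightarrow> \<exists>!v. v \<in> L \<and> op u v = w"

locale ternary_system =
  fixes M :: "'m set" and \<mu> :: "'m \<Rightarrow> 'm \<Rightarrow> 'm \<Rightarrow> 'm"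
  assumes nonempty: "M \<noteq> {}"
    and closed: "a \<in> M \<Longrightarrow> b \<in> M \<Longrightarrow> c \<in> M \<Longrightarrow> \<mu> a b c \<in> M"

definition ldiv :: "'a set \<Rightarrow> ('a \<Rightarrow> 'a \<Rightarrow> 'a) \<Rightarrow> 'a \<Rightarrow> 'a \<Rightarrow> 'a" where
  "ldiv L op u w = (THE v. v \<in> L \<and> op u v = w)"

text \<open>All functions below are meaningful only on the carriers; the inverse of a bijection
  defined on a carrier \<open>A\<close> is \<open>inv_into A\<close>. The arguments of \<open>\<xi>\<close>, \<open>\<eta>\<close> and \<open>R\<close> before
  \<open>l\<close> represent the superscript \<open>(L, M, \<pi>)\<close>; the carrier of \<open>M\<close> does not occur in the formulas.\<close>

definition xi :: "'a set \<Rightarrow> ('a \<Rightarrow> 'a \<Rightarrow> 'a) \<Rightarrow> ('m \<Rightarrow> 'm \<Rightarrow> 'm \<Rightarrow> 'm) \<Rightarrow> ('a \<Rightarrow> 'm)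
    \<Rightarrow> 'a \<Rightarrow> 'a \<Rightarrow> 'a \<Rightarrow> 'a" where
  "xi L op \<mu> \<pi> l u v =
    ldiv L op l (inv_into L \<pi> (\<mu> (\<pi> l) (\<pi> (op l u)) (\<pi> (op (op l u) v))))"

definition eta :: "'a set \<Rightarrow> ('a \<Rightarrow> 'a \<Rightarrow> 'a) \<Rightarrow> ('m \<Rightarrow> 'm \<Rightarrow> 'm \<Rightarrow> 'm) \<Rightarrow> ('a \<Rightarrow> 'm)
    \<Rightarrow> 'a \<Rightarrow> 'a \<Rightarrow> 'a \<Rightarrow> 'a" where
  "eta L op \<mu> \<pi> l u v = ldiv L op (op l (xi L op \<mu> \<pi> l v u)) (op (op l v) u)"

definition R :: "'a set \<Rightarrow> ('a \<Rightarrow> 'a \<Rightarrow> 'a) \<Rightarrow> ('m \<Rightarrow> 'm \<Rightarrow> 'm \<Rightarrow> 'm) \<Rightarrow> ('a \<Rightarrow> 'm)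
    \<Rightarrow> 'a \<Rightarrow> 'a \<times> 'a \<Rightarrow> 'a \<times> 'a" where
  "R L op \<mu> \<pi> l = (\<lambda>(u, v). (eta L op \<mu> \<pi> l v u, xi L op \<mu> \<pi> l u v))"

definition R21 :: "'a set \<Rightarrow> ('a \<Rightarrow> 'a \<Rightarrow> 'a) \<Rightarrow> ('m \<Rightarrow> 'm \<Rightarrow> 'm \<Rightarrow> 'm) \<Rightarrow> ('a \<Rightarrow> 'm)
    \<Rightarrow> 'a \<Rightarrow> 'a \<times> 'a \<Rightarrow> 'a \<times> 'a" where
  "R21 L op \<mu> \<pi> l = prod.swap \<circ> R L op \<mu> \<pi> l \<circ> prod.swap"

definition ftilde :: "('a \<Rightarrow> 'a \<Rightarrow> 'a) \<Rightarrow> 'a \<Rightarrow> 'a \<times> 'a \<Rightarrow> 'a \<times> 'a" where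
  "ftilde op l = (\<lambda>(u, v). (op l u, op (op l u) v))"

definition J :: "('a \<Rightarrow> 'a \<Rightarrow> 'a) \<Rightarrow> ('a \<Rightarrow> 'm) \<Rightarrow> 'b set \<Rightarrow> ('b \<Rightarrow> 'b \<Rightarrow> 'b)
    \<Rightarrow> ('b \<Rightarrow> 'm) \<Rightarrow> 'a \<Rightarrow> 'a \<times> 'a \<Rightarrow> 'b \<times> 'b" where
  "J op1 \<pi>1 L2 op2 \<pi>2 l =
    inv_into (L2 \<times> L2) (ftilde op2 (inv_into L2 \<pi>2 (\<pi>1 l)))
    \<circ> map_prod (inv_into L2 \<pi>2 \<circ> \<pi>1) (inv_into L2 \<pi>2 \<circ> \<pi>1)
    \<circ> ftilde op1 l \<circ> prod.swap"

definition J21 :: "('a \<Rightarrow> 'a \<Rightarrow> 'a) \<Rightarrow> ('a \<Rightarrow> 'm) \<Rightarrow> 'b set \<Rightarrow> ('b \<Rightarrow> 'b \<Rightarrow> 'b)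
    \<Rightarrow> ('b \<Rightarrow> 'm) \<Rightarrow> 'a \<Rightarrow> 'a \<times> 'a \<Rightarrow> 'b \<times> 'b" where
  "J21 op1 \<pi>1 L2 op2 \<pi>2 l = prod.swap \<circ> J op1 \<pi>1 L2 op2 \<pi>2 l \<circ> prod.swap"

text \<open>The following facts justify the uses of \<open>ldiv\<close> and \<open>inv_into\<close>.\<close>

lemma (in left_quasigroup) ldiv:
  assumes "u \<in> L" "w \<in> L"
  shows "ldiv L op u w \<in> L" "op u (ldiv L op u w) = w"
  using theI'[OF unique_solution[OF assms]] by (simp_all add: ldiv_def)

lemma (in left_quasigroup) bij_betw_ftilde:
  assumes l: "l \<in> L"
  shows "bij_betw (ftilde op l) (L \<times> L) (L \<times> L)"
proof (rule bij_betw_byWitness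
    [where f' = "\<lambda>(a, b). (ldiv L op l a, ldiv L op a b)"])
  have cancel: "ldiv L op u (op u v) = v" if "u \<in> L" "v \<in> L" for u v
    using unique_solution[OF that(1) closed[OF that]] ldiv[OF that(1) closed[OF that]] that
    by blast
  show "\<forall>x\<in>L \<times> L. (\<lambda>(a, b). (ldiv L op l a, ldiv L op a b)) (ftilde op l x) = x"
    by (auto simp: ftilde_def cancel l closed)
  show "\<forall>x\<in>L \<times> L. ftilde op l ((\<lambda>(a, b). (ldiv L op l a, ldiv L op a b)) x) = x"
    by (auto simp: ftilde_def ldiv l)
  show "ftilde op l ` (L \<times> L) \<subseteq> L \<times> L"
    by (auto simp: ftilde_def l closed)
  show "(\<lambda>(a, b). (ldiv L op l a, ldiv L op a b)) ` (L \<times> L) \<subseteq> L \<times> L"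
    by (auto simp: ldiv l)
qed

lemma bij_betw_J:
  assumes "left_quasigroup L1 op1" "left_quasigroup L2 op2"
    and \<pi>1: "bij_betw \<pi>1 L1 M" and \<pi>2: "bij_betw \<pi>2 L2 M" and l: "l \<in> L1"
  shows "bij_betw (J op1 \<pi>1 L2 op2 \<pi>2 l) (L1 \<times> L1) (L2 \<times> L2)"
proof -
  interpret L1: left_quasigroup L1 op1 by fact
  interpret L2: left_quasigroup L2 op2 by fact
  have p: "bij_betw (inv_into L2 \<pi>2 \<circ> \<pi>1) L1 L2"
    using \<pi>1 bij_betw_inv_into[OF \<pi>2] by (rule bij_betw_trans)
  then have l2: "inv_into L2 \<pi>2 (\<pi>1 l) \<in> L2"
    using l by (auto dest: bij_betwE)
  have "bij_betw prod.swap (L1 \<times> L1) (L1 \<times> L1)"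
    by (rule bij_betw_byWitness[where f' = prod.swap]) auto
  from bij_betw_trans[OF this L1.bij_betw_ftilde[OF l]]
  have "bij_betw (ftilde op1 l \<circ> prod.swap) (L1 \<times> L1) (L1 \<times> L1)" .
  from bij_betw_trans[OF bij_betw_trans[OF this bij_betw_map_prod[OF p p]]
      bij_betw_inv_into[OF L2.bij_betw_ftilde[OF l2]]]
  show ?thesis
    by (simp add: J_def comp_assoc)
qed

end

theory Submission imports Defs begin

text \<open>Read a pair \<open>(u, v)\<close> as the path \<open>l, l u, (l u) v\<close> starting at \<open>l\<close>, and record the labels
  in \<open>M\<close> of its last two vertices. These labels form a bijective coordinate system
  \<open>F\<^sub>l\<close> from \<open>L \<times> L\<close> to \<open>M \<times> M\<close>. The definitions of \<open>\<xi>\<close> and \<open>\<eta>\<close> say precisely that \<open>R\<close>,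
  followed by a swap, moves the middle vertex and fixes the end point (lemma \<open>path_labels_R\<close>):
  with \<open>a = \<pi> l\<close> and \<open>T\<^sub>a (b, c) = (\<mu> a b c, c)\<close>, one has \<open>F\<^sub>l \<circ> P \<circ> R(l) = T\<^sub>a \<circ> F\<^sub>l\<close>,
  where \<open>P\<close> is the swap.
  The map \<open>T\<^sub>a\<close> depends only on the ternary system. Replacing \<open>(L\<^sub>1, \<pi>\<^sub>1)\<close> by \<open>(L\<^sub>2, \<pi>\<^sub>2)\<close>
  therefore only changes the coordinates, and \<open>J\<close> is the change of coordinates (with a swap):
  \<open>F\<^sub>2 \<circ> J = F\<^sub>1 \<circ> P\<close> (lemma \<open>path_labels_J\<close>). Read in the coordinates \<open>F\<^sub>2\<close>, both
  \<open>J \<circ> R\<^sub>1\<close> and \<open>R\<^sub>2\<^sup>2\<^sup>1 \<circ> J\<^sup>2\<^sup>1\<close> become \<open>T\<^sub>a \<circ> F\<^sub>1\<close>, so they agree.\<close>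

definition path_labels :: "('a \<Rightarrow> 'a \<Rightarrow> 'a) \<Rightarrow> ('a \<Rightarrow> 'm) \<Rightarrow> 'a \<Rightarrow> 'a \<times> 'a \<Rightarrow> 'm \<times> 'm" where
  "path_labels op \<pi> l = map_prod \<pi> \<pi> \<circ> ftilde op l"

definition move_middle :: "('m \<Rightarrow> 'm \<Rightarrow> 'm \<Rightarrow> 'm) \<Rightarrow> 'm \<Rightarrow> 'm \<times> 'm \<Rightarrow> 'm \<times> 'm" where
  "move_middle \<mu> a = (\<lambda>(b, c). (\<mu> a b c, c))"

lemma (in left_quasigroup) bij_betw_path_labels:
  assumes "bij_betw \<pi> L M" and "l \<in> L"
  shows "bij_betw (path_labels op \<pi> l) (L \<times> L) (M \<times> M)"
  unfolding path_labels_def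
  by (rule bij_betw_trans[OF bij_betw_ftilde bij_betw_map_prod]) (use assms in auto)

lemma (in left_quasigroup) xi_eta_path:
  assumes "ternary_system M \<mu>" and \<pi>: "bij_betw \<pi> L M"
    and l: "l \<in> L" and u: "u \<in> L" and v: "v \<in> L"
  shows "xi L op \<mu> \<pi> l u v \<in> L" and "eta L op \<mu> \<pi> l v u \<in> L"
    and "\<pi> (op l (xi L op \<mu> \<pi> l u v)) = \<mu> (\<pi> l) (\<pi> (op l u)) (\<pi> (op (op l u) v))"
    and "op (op l (xi L op \<mu> \<pi> l u v)) (eta L op \<mu> \<pi> l v u) = op (op l u) v"
proof -
  interpret M: ternary_system M \<mu> by fact
  let ?m = "\<mu> (\<pi> l) (\<pi> (op l u)) (\<pi> (op (op l u) v))"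
  have m: "?m \<in> M"
    by (intro M.closed bij_betw_apply[OF \<pi>] closed l u v)
  have p: "inv_into L \<pi> ?m \<in> L"
    by (rule bij_betw_apply[OF bij_betw_inv_into[OF \<pi>] m])
  show xi: "xi L op \<mu> \<pi> l u v \<in> L"
    unfolding xi_def by (rule ldiv(1)[OF l p])
  show "\<pi> (op l (xi L op \<mu> \<pi> l u v)) = ?m"
    unfolding xi_def using ldiv(2)[OF l p] bij_betw_inv_into_right[OF \<pi> m] by simp
  show "eta L op \<mu> \<pi> l v u \<in> L"
    and "op (op l (xi L op \<mu> \<pi> l u v)) (eta L op \<mu> \<pi> l v u) = op (op l u) v"
    unfolding eta_def by (intro ldiv closed l u v xi)+
qed

lemma (in left_quasigroup) R_in_carrier:
  assumes "ternary_system M \<mu>" and "bij_betw \<pi> L M" and "l \<in> L" and "x \<in> L \<times> L"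
  shows "R L op \<mu> \<pi> l x \<in> L \<times> L"
proof -
  obtain u v where "x = (u, v)" and "u \<in> L" and "v \<in> L"
    using assms(4) by blast
  then show ?thesis
    using xi_eta_path(1,2)[OF assms(1-3)] by (simp add: R_def)
qed

text \<open>The element \<open>\<xi>\<^sub>l(u)(v)\<close> is the step from \<open>l\<close> to the new middle vertex, and \<open>\<eta>\<^sub>l(v)(u)\<close>
  is the step from there to the old end point. The swap is needed because \<open>R\<close> lists
  the second step first.\<close>

lemma (in left_quasigroup) path_labels_R:
  assumes "ternary_system M \<mu>" and "bij_betw \<pi> L M" and "l \<in> L" and "x \<in> L \<times> L"
  shows "path_labels op \<pi> l (prod.swap (R L op \<mu> \<pi> l x)) =
    move_middle \<mu> (\<pi> l) (path_labels op \<pi> l x)"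
proof -
  obtain u v where "x = (u, v)" and "u \<in> L" and "v \<in> L"
    using assms(4) by blast
  then show ?thesis
    using xi_eta_path(3,4)[OF assms(1-3)]
    by (simp add: path_labels_def move_middle_def ftilde_def R_def)
qed

text \<open>Transporting by \<open>\<pi>\<^sub>2\<^sup>-\<^sup>1 \<pi>\<^sub>1\<close> keeps labels, so \<open>J\<close> replaces a path in \<open>L\<^sub>1\<close> by the path in
  \<open>L\<^sub>2\<close> with the same labels.\<close>

lemma path_labels_J:
  assumes "left_quasigroup L1 op1" and "left_quasigroup L2 op2"
    and \<pi>1: "bij_betw \<pi>1 L1 M" and \<pi>2: "bij_betw \<pi>2 L2 M"
    and l: "l \<in> L1" and y: "y \<in> L1 \<times> L1"
  shows "path_labels op2 \<pi>2 (inv_into L2 \<pi>2 (\<pi>1 l)) (J op1 \<pi>1 L2 op2 \<pi>2 l y) =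
    path_labels op1 \<pi>1 l (prod.swap y)"
proof -
  interpret L1: left_quasigroup L1 op1 by fact
  interpret L2: left_quasigroup L2 op2 by fact
  let ?p = "inv_into L2 \<pi>2 \<circ> \<pi>1"
  have p: "bij_betw ?p L1 L2"
    using \<pi>1 bij_betw_inv_into[OF \<pi>2] by (rule bij_betw_trans)
  have \<pi>2_p: "\<pi>2 (?p u) = \<pi>1 u" if "u \<in> L1" for u
    using bij_betw_inv_into_right[OF \<pi>2 bij_betw_apply[OF \<pi>1 that]] by simp
  have f2: "bij_betw (ftilde op2 (?p l)) (L2 \<times> L2) (L2 \<times> L2)"
    by (rule L2.bij_betw_ftilde[OF bij_betw_apply[OF p l]])
  have "prod.swap y \<in> L1 \<times> L1"
    using y by (simp add: mem_Times_iff)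
  then have z: "ftilde op1 l (prod.swap y) \<in> L1 \<times> L1"
    by (rule bij_betw_apply[OF L1.bij_betw_ftilde[OF l]])
  then have "map_prod ?p ?p (ftilde op1 l (prod.swap y)) \<in> L2 \<times> L2"
    by (rule bij_betw_apply[OF bij_betw_map_prod[OF p p]])
  from bij_betw_inv_into_right[OF f2 this]
  have "ftilde op2 (?p l) (J op1 \<pi>1 L2 op2 \<pi>2 l y) =
      map_prod ?p ?p (ftilde op1 l (prod.swap y))"
    by (simp add: J_def)
  moreover obtain b c where "ftilde op1 l (prod.swap y) = (b, c)" and "b \<in> L1" and "c \<in> L1"
    using z by blast
  ultimately show ?thesis
    using \<pi>2_p by (simp add: path_labels_def)
qed

theorem proposition8p1:
  fixes L1 :: "'a set" and op1 :: "'a \<Rightarrow> 'a \<Rightarrow> 'a"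
    and L2 :: "'b set" and op2 :: "'b \<Rightarrow> 'b \<Rightarrow> 'b"
    and M :: "'m set" and \<mu> :: "'m \<Rightarrow> 'm \<Rightarrow> 'm \<Rightarrow> 'm"
    and \<pi>1 :: "'a \<Rightarrow> 'm" and \<pi>2 :: "'b \<Rightarrow> 'm"
  assumes "left_quasigroup L1 op1" and "left_quasigroup L2 op2"
    and "ternary_system M \<mu>"
    and "\<And>a b c d. \<lbrakk>a \<in> M; b \<in> M; c \<in> M; d \<in> M\<rbrakk> \<Longrightarrow>
      \<mu> a (\<mu> a b c) (\<mu> (\<mu> a b c) c d) = \<mu> a b (\<mu> b c d)"
    and "\<And>a b c d. \<lbrakk>a \<in> M; b \<in> M; c \<in> M; d \<in> M\<rbrakk> \<Longrightarrow>
      \<mu> (\<mu> a b c) c d = \<mu> (\<mu> a b (\<mu> b c d)) (\<mu> b c d) d"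
    and "bij_betw \<pi>1 L1 M" and "bij_betw \<pi>2 L2 M"
  shows "\<forall>l1\<in>L1. \<forall>x\<in>L1 \<times> L1.
    R L1 op1 \<mu> \<pi>1 l1 x =
      (inv_into (L1 \<times> L1) (J op1 \<pi>1 L2 op2 \<pi>2 l1)
       \<circ> R21 L2 op2 \<mu> \<pi>2 (inv_into L2 \<pi>2 (\<pi>1 l1))
       \<circ> J21 op1 \<pi>1 L2 op2 \<pi>2 l1) x"
proof (intro ballI)
  interpret L1: left_quasigroup L1 op1 by fact
  interpret L2: left_quasigroup L2 op2 by fact
  fix l1 x assume l1: "l1 \<in> L1" and x: "x \<in> L1 \<times> L1"
  note \<pi>1 = \<open>bij_betw \<pi>1 L1 M\<close> and \<pi>2 = \<open>bij_betw \<pi>2 L2 M\<close>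
  note M = \<open>ternary_system M \<mu>\<close>
  let ?l2 = "inv_into L2 \<pi>2 (\<pi>1 l1)"
  let ?J = "J op1 \<pi>1 L2 op2 \<pi>2 l1"
  let ?R1 = "R L1 op1 \<mu> \<pi>1 l1" and ?R2 = "R L2 op2 \<mu> \<pi>2 ?l2"
  let ?F1 = "path_labels op1 \<pi>1 l1" and ?F2 = "path_labels op2 \<pi>2 ?l2"
  have a: "\<pi>1 l1 \<in> M"
    by (rule bij_betw_apply[OF \<pi>1 l1])
  have l2: "?l2 \<in> L2"
    by (rule bij_betw_apply[OF bij_betw_inv_into[OF \<pi>2] a])
  have \<pi>2_l2: "\<pi>2 ?l2 = \<pi>1 l1"
    by (rule bij_betw_inv_into_right[OF \<pi>2 a])
  have J: "bij_betw ?J (L1 \<times> L1) (L2 \<times> L2)"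
    by (rule bij_betw_J[OF assms(1,2) \<pi>1 \<pi>2 l1])
  note F_J = path_labels_J[OF assms(1,2) \<pi>1 \<pi>2 l1]
  have R1x: "?R1 x \<in> L1 \<times> L1"
    by (rule L1.R_in_carrier[OF M \<pi>1 l1 x])
  have swap_x: "prod.swap x \<in> L1 \<times> L1"
    using x by (simp add: mem_Times_iff)
  have Jx: "?J (prod.swap x) \<in> L2 \<times> L2"
    by (rule bij_betw_apply[OF J swap_x])

  have "?F2 (?J (?R1 x)) = move_middle \<mu> (\<pi>1 l1) (?F1 x)"
    by (simp only: F_J[OF R1x] L1.path_labels_R[OF M \<pi>1 l1 x])
  also have "\<dots> = move_middle \<mu> (\<pi>2 ?l2) (?F2 (?J (prod.swap x)))"
    by (simp add: \<pi>2_l2 F_J[OF swap_x])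
  also have "\<dots> = ?F2 (prod.swap (?R2 (?J (prod.swap x))))"
    by (rule L2.path_labels_R[OF M \<pi>2 l2 Jx, symmetric])
  finally have "?J (?R1 x) = prod.swap (?R2 (?J (prod.swap x)))"
  proof (rule inj_onD[OF bij_betw_imp_inj_on[OF L2.bij_betw_path_labels[OF \<pi>2 l2]]])
    show "?J (?R1 x) \<in> L2 \<times> L2"
      by (rule bij_betw_apply[OF J R1x])
    show "prod.swap (?R2 (?J (prod.swap x))) \<in> L2 \<times> L2"
      using L2.R_in_carrier[OF M \<pi>2 l2 Jx] by (simp add: mem_Times_iff)
  qed
  \<comment> \<open>The adjacent swaps of \<open>R21\<close> and \<open>J21\<close> cancel, leaving the right-hand side just obtained.\<close>
  then have "?J (?R1 x) = (R21 L2 op2 \<mu> \<pi>2 ?l2 \<circ> J21 op1 \<pi>1 L2 op2 \<pi>2 l1) x"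
    by (simp add: R21_def J21_def)
  then show "?R1 x = (inv_into (L1 \<times> L1) ?J \<circ> R21 L2 op2 \<mu> \<pi>2 ?l2
      \<circ> J21 op1 \<pi>1 L2 op2 \<pi>2 l1) x"
    using bij_betw_inv_into_left[OF J R1x] by simp
qed

end
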